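(* Let $G$ be a finite simple graph without isolated vertices on the vertex set $[n]$, and let $\mathbf{k}=(k_1,\ldots,k_n)\in\mathbb{N}^n$ satisfy $1\le k_i\le \deg_G(i)+1$ for all $i$. Then $$\operatorname{height}(\mathrm{NI}_{\mathbf{k}}(G))=\gamma(G,\mathbf{m}),$$ where $\mathbf{m}=(m_1,\ldots,m_n)$ is the vector defined by $m_i=\deg_G(i)-k_i+2$ for all $i\in[n]$.
   Context: $K$ is a field and $S=K[x_1,\ldots,x_n]$. For a vertex $i$ of $G$, $N_G[i]$ is the closed neighborhood of $i$, and for $W\subseteq[n]$ put $\mathbf{x}_W=\prod_{j\in W}x_j$. The $\mathbf{k}$-neighborhood ideal of $G$ is $$\mathrm{NI}_{\mathbf{k}}(G)=\sum_{i=1}^n\big(\mathbf{x}_W:\ W\subseteq N_G[i],\ |W|=k_i\big)\subseteq S.$$ For $\mathbf{m}=(m_1,\ldots,m_n)\in\mathbb{N}^n$ with $1\le m_i\le\deg_G(i)+1$ for all $i$, a subset $D\subseteq[n]$ is an $\mathbf{m}$-multiple dominating set of $G$ if $|N_G[i]\cap D|\ge m_i$ for all $i\in[n]$, and $\gamma(G,\mathbf{m})$ denotes the minimum cardinality of an $\mathbf{m}$-multiple dominating set of $G$. *)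

theory Defs
  imports
    "HOL-Algebra.Ideal"
    "HOL-Library.Poly_Mapping"
    "HOL-Library.Extended_Nat"
    "Graph_Theory.Pair_Digraph"
begin

section \<open>Polynomial rings in several variables\<close>

text \<open>
  A monomial is its finitely supported exponent vector of type \<open>nat \<Rightarrow>\<^sub>0 nat\<close>, and a polynomial is
  the finitely supported family of its coefficients, indexed by monomials. The addition and
  multiplication of \<open>poly_mapping\<close> are then those of polynomials in the variables \<open>x\<^sub>j\<close>, \<open>j :: nat\<close>;
  \<open>mpoly_ring V\<close> is the subring of the polynomials in which only variables \<open>x\<^sub>j\<close> with \<open>j \<in> V\<close> occur.
\<close>

type_synonym 'k mpoly = "(nat \<Rightarrow>\<^sub>0 nat) \<Rightarrow>\<^sub>0 'k"

definition mpoly_ring :: "nat set \<Rightarrow> 'k::field mpoly ring" where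
  "mpoly_ring V =
     \<lparr> carrier = {p. \<forall>a \<in> Poly_Mapping.keys p. Poly_Mapping.keys a \<subseteq> V},
       monoid.mult = (*), one = 1, ring.zero = 0, add = (+) \<rparr>"

definition mvar :: "nat \<Rightarrow> 'k::field mpoly" where
  "mvar j = Poly_Mapping.single (Poly_Mapping.single j 1) 1"

lemma cring_mpoly_ring: "cring (mpoly_ring V :: 'k::field mpoly ring)"
proof (rule cringI)
  show "abelian_group (mpoly_ring V :: 'k mpoly ring)"
  proof (rule abelian_groupI)
    fix x :: "'k mpoly"
    assume "x \<in> carrier (mpoly_ring V)"
    then show "\<exists>y \<in> carrier (mpoly_ring V). y \<oplus>\<^bsub>mpoly_ring V\<^esub> x = \<zero>\<^bsub>mpoly_ring V\<^esub>"
      by (intro bexI[of _ "- x"]) (auto simp: mpoly_ring_def)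
  qed (use Poly_Mapping.keys_add in \<open>fastforce simp: mpoly_ring_def algebra_simps\<close>)+
  show "comm_monoid (mpoly_ring V :: 'k mpoly ring)"
  proof (rule comm_monoidI)
    fix p q :: "'k mpoly"
    assume pq: "p \<in> carrier (mpoly_ring V)" "q \<in> carrier (mpoly_ring V)"
    have "Poly_Mapping.keys a \<subseteq> V" if a: "a \<in> Poly_Mapping.keys (p * q)" for a
    proof -
      from a keys_mult[of p q] obtain b c
        where "a = b + c" "b \<in> Poly_Mapping.keys p" "c \<in> Poly_Mapping.keys q" by blast
      with pq Poly_Mapping.keys_add[of b c] show ?thesis by (simp add: mpoly_ring_def) blast
    qed
    then show "p \<otimes>\<^bsub>mpoly_ring V\<^esub> q \<in> carrier (mpoly_ring V)"
      by (simp add: mpoly_ring_def)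
  qed (simp_all add: mpoly_ring_def mult.assoc mult.commute)
qed (simp add: mpoly_ring_def distrib_right)


section \<open>Height\<close>

definition prime_chain :: "('a, 'b) ring_scheme \<Rightarrow> 'a set \<Rightarrow> nat \<Rightarrow> (nat \<Rightarrow> 'a set) \<Rightarrow> bool" where
  "prime_chain R P r C \<longleftrightarrow>
     (\<forall>i \<le> r. primeideal (C i) R) \<and> (\<forall>i < r. C i \<subset> C (Suc i)) \<and> C r = P"

definition prime_height :: "('a, 'b) ring_scheme \<Rightarrow> 'a set \<Rightarrow> enat" where
  "prime_height R P = (SUP r \<in> {r. \<exists>C. prime_chain R P r C}. enat r)"

definition ideal_height :: "('a, 'b) ring_scheme \<Rightarrow> 'a set \<Rightarrow> enat" where
  "ideal_height R I = (INF P \<in> {P. primeideal P R \<and> I \<subseteq> P}. prime_height R P)"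


section \<open>Neighborhood ideals and multiple domination\<close>

text \<open>
  A finite simple graph is a \<open>pair_graph\<close>: an edge \<open>{i, j}\<close> is stored as the two arcs \<open>(i, j)\<close> and
  \<open>(j, i)\<close>, so the degree of a vertex is its out-degree.
\<close>

abbreviation graph_degree :: "'v pair_pre_digraph \<Rightarrow> 'v \<Rightarrow> nat" where
  "graph_degree G i \<equiv> out_degree (with_proj G) i"

definition closed_nbhd :: "'v pair_pre_digraph \<Rightarrow> 'v \<Rightarrow> 'v set" where
  "closed_nbhd G i = insert i {j. (i, j) \<in> parcs G}"

text \<open>The sum of a family of ideals is the ideal generated by their union.\<close>

definition nbhd_ideal :: "nat pair_pre_digraph \<Rightarrow> (nat \<Rightarrow> nat) \<Rightarrow> 'k::field mpoly set" where
  "nbhd_ideal G k =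
     Idl\<^bsub>mpoly_ring (pverts G)\<^esub> (\<Union>i \<in> pverts G.
       Idl\<^bsub>mpoly_ring (pverts G)\<^esub> {\<Prod>j\<in>W. mvar j | W. W \<subseteq> closed_nbhd G i \<and> card W = k i})"

definition multiple_dominating :: "'v pair_pre_digraph \<Rightarrow> ('v \<Rightarrow> nat) \<Rightarrow> 'v set \<Rightarrow> bool" where
  "multiple_dominating G m D \<longleftrightarrow>
     D \<subseteq> pverts G \<and> (\<forall>i \<in> pverts G. m i \<le> card (closed_nbhd G i \<inter> D))"

text \<open>
  For \<open>m i \<le> graph_degree G i + 1\<close> on all vertices, the whole vertex set is dominating, so the
  minimum is over a nonempty set.
\<close>

definition multiple_domination_number :: "'v pair_pre_digraph \<Rightarrow> ('v \<Rightarrow> nat) \<Rightarrow> nat" where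
  "multiple_domination_number G m = Min (card ` {D. multiple_dominating G m D})"

end

theory Submission
  imports Defs
begin

text \<open>
  For a set \<open>D\<close> of vertices write \<open>P\<^sub>D\<close> for the ideal generated by the variables \<open>x\<^sub>j\<close>, \<open>j \<in> D\<close>; it is prime. A prime that
  contains a product of variables contains one of them, so a prime \<open>P\<close> contains the neighborhood
  ideal exactly when the set \<open>D\<close> of those \<open>j\<close> with \<open>x\<^sub>j \<in> P\<close> meets every \<open>k i\<close>-subset of every closed
  neighborhood. As a closed neighborhood has \<open>graph_degree G i + 1\<close> elements, this says that at
  least \<open>graph_degree G i + 2 - k i = m i\<close> of them lie in \<open>D\<close>, that is, \<open>D\<close> is multiply dominating
  (\<open>multiple_dominating_iff_meets\<close>). Hence the \<open>P\<^sub>D\<close> with \<open>D\<close> multiply dominating lie over the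
  neighborhood ideal, and every prime over it contains one of them. It remains to see that \<open>P\<^sub>D\<close> has
  height \<open>card D\<close>.

  The height is at least \<open>card D\<close>, for \<open>P\<^sub>D\<close> and for every prime above it, since the variables can
  be adjoined one at a time (\<open>card_le_prime_height\<close>). For the upper bound, every chain of primes
  ending in \<open>P\<^sub>D\<close> can be prolonged by \<open>card (V - D)\<close> further ideals of this form, and a chain of
  primes in a polynomial ring in \<open>card V\<close> variables has length at most \<open>card V\<close>
  (\<open>prime_chain_length_le_card_variables\<close>).

  That bound on the dimension has an elementary proof. From a chain \<open>C 0 \<subset> \<dots> \<subset> C r\<close> of primes pick
  \<open>f i \<in> C (Suc i) - C i\<close>. The elements \<open>f 0, \<dots>, f (r - 1)\<close> are algebraically independent over the
  field: modulo \<open>C 0\<close> a relation can be divided by the largest power of \<open>f 0\<close> that divides it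
  formally, and setting \<open>f 0\<close> to zero modulo \<open>C 1\<close> then leaves a relation among the others
  (\<open>chain_witnesses_algebraically_independent\<close>). But more than \<open>card V\<close> polynomials in \<open>card V\<close>
  variables are algebraically dependent, because there are more products of their powers than
  monomials available to express these products (\<open>algebraic_relation_if_too_many\<close>).
\<close>

section \<open>The polynomial ring\<close>

lemma mpoly_ring_simps [simp]:
  "monoid.mult (mpoly_ring V) = (*)" "one (mpoly_ring V) = 1"
  "ring.zero (mpoly_ring V) = 0" "add (mpoly_ring V) = (+)"
  by (simp_all add: mpoly_ring_def)

lemma mem_carrier_mpoly_ring:
  "p \<in> carrier (mpoly_ring V) \<longleftrightarrow> (\<forall>a \<in> Poly_Mapping.keys p. Poly_Mapping.keys a \<subseteq> V)"
  by (simp add: mpoly_ring_def)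

lemma keys_monom_add:
  "Poly_Mapping.keys (a + b) = Poly_Mapping.keys a \<union> Poly_Mapping.keys (b :: nat \<Rightarrow>\<^sub>0 nat)"
  by (auto simp: in_keys_iff lookup_add)

lemma keys_mult_cases:
  fixes p q :: "'k::field mpoly"
  assumes "a \<in> Poly_Mapping.keys (p * q)"
  obtains b c where "a = b + c" "b \<in> Poly_Mapping.keys p" "c \<in> Poly_Mapping.keys q"
  using assms keys_mult[of p q] by blast

lemma const_in_carrier: "Poly_Mapping.single 0 c \<in> carrier (mpoly_ring V)"
  by (simp add: mem_carrier_mpoly_ring)

lemma mvar_in_carrier: "j \<in> V \<Longrightarrow> mvar j \<in> carrier (mpoly_ring V)"
  by (simp add: mem_carrier_mpoly_ring mvar_def)

lemma carrier_mult:
  assumes "p \<in> carrier (mpoly_ring V)" "q \<in> carrier (mpoly_ring V)"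
  shows "p * q \<in> carrier (mpoly_ring V)"
  using cring.cring_simprules(5)[OF cring_mpoly_ring, of p V q] assms by simp

lemma carrier_one: "1 \<in> carrier (mpoly_ring V)"
  using cring.cring_simprules(6)[OF cring_mpoly_ring, of V] by simp

lemma carrier_power:
  "p \<in> carrier (mpoly_ring V) \<Longrightarrow> p ^ e \<in> carrier (mpoly_ring V)"
  by (induction e) (auto intro: carrier_mult carrier_one)

lemma carrier_prod:
  "(\<And>i. i \<in> A \<Longrightarrow> f i \<in> carrier (mpoly_ring V)) \<Longrightarrow> prod f A \<in> carrier (mpoly_ring V)"
  by (induction A rule: infinite_finite_induct) (auto intro: carrier_mult carrier_one)

lemma mpoly_expansion:
  "p = (\<Sum>a \<in> Poly_Mapping.keys p. Poly_Mapping.single 0 (Poly_Mapping.lookup p a)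
          * Poly_Mapping.single a (1 :: 'k::field))"
  (is "p = ?s")
proof (rule poly_mapping_eqI)
  fix b
  show "Poly_Mapping.lookup p b = Poly_Mapping.lookup ?s b"
    by (auto simp: mult_single lookup_sum lookup_single when_def in_keys_iff)
qed


section \<open>Ideals and primes of the polynomial ring\<close>

context
  fixes V :: "nat set" and P :: "'k::field mpoly set"
  assumes P: "ideal P (mpoly_ring V)"
begin

interpretation ideal P "mpoly_ring V" by (rule P)

lemma mpoly_ideal_subset: "P \<subseteq> carrier (mpoly_ring V)"
  using a_subset by simp

lemma mpoly_ideal_zero: "0 \<in> P"
  using additive_subgroup.zero_closed[OF is_additive_subgroup] by simp

lemma mpoly_ideal_add: "p \<in> P \<Longrightarrow> q \<in> P \<Longrightarrow> p + q \<in> P"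
  using additive_subgroup.a_closed[OF is_additive_subgroup, of p q] by simp

lemma mpoly_ideal_mult: "p \<in> carrier (mpoly_ring V) \<Longrightarrow> q \<in> P \<Longrightarrow> p * q \<in> P"
  using I_l_closed[of q p] by simp

lemma mpoly_ideal_diff:
  assumes "p \<in> P" "q \<in> P"
  shows "p - q \<in> P"
proof -
  have "Poly_Mapping.single 0 (-1) * q = - q"
    by (simp add: single_uminus flip: single_one)
  then have "- q \<in> P"
    using mpoly_ideal_mult[OF const_in_carrier assms(2), of "-1"] by simp
  then show ?thesis
    using mpoly_ideal_add[OF assms(1)] by fastforce
qed

lemma mpoly_ideal_sum: "(\<And>i. i \<in> A \<Longrightarrow> f i \<in> P) \<Longrightarrow> sum f A \<in> P"
  by (induction A rule: infinite_finite_induct) (auto intro: mpoly_ideal_zero mpoly_ideal_add)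

end

context
  fixes V :: "nat set" and P :: "'k::field mpoly set"
  assumes P: "primeideal P (mpoly_ring V)"
begin

interpretation primeideal P "mpoly_ring V" by (rule P)

lemma mpoly_prime_ideal: "ideal P (mpoly_ring V)"
  by (rule is_ideal)

lemma mpoly_prime_mult:
  "p \<in> carrier (mpoly_ring V) \<Longrightarrow> q \<in> carrier (mpoly_ring V) \<Longrightarrow> p * q \<in> P \<Longrightarrow> p \<in> P \<or> q \<in> P"
  using I_prime[of p q] by simp

lemma mpoly_prime_one: "1 \<notin> P"
  using one_imp_carrier I_notcarr by auto

lemma mpoly_prime_power:
  assumes "p \<in> carrier (mpoly_ring V)" "p ^ e \<in> P"
  shows "p \<in> P"
  using assms(2)
proof (induction e)
  case (Suc e)
  then show ?case
    using mpoly_prime_mult[OF assms(1) carrier_power[OF assms(1)], of e] by auto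
qed (simp add: mpoly_prime_one)

lemma mpoly_prime_prod:
  assumes "\<And>i. i \<in> A \<Longrightarrow> f i \<in> carrier (mpoly_ring V)" "prod f A \<in> P"
  shows "\<exists>i \<in> A. f i \<in> P"
  using assms
proof (induction A rule: infinite_finite_induct)
  case (insert i A)
  then show ?case
    using mpoly_prime_mult[of "f i" "prod f A"] carrier_prod[of A f] by auto
qed (auto simp: mpoly_prime_one)

lemma mpoly_prime_const:
  assumes "Poly_Mapping.single 0 c \<in> P"
  shows "c = 0"
proof (rule ccontr)
  assume "c \<noteq> 0"
  then have "Poly_Mapping.single 0 (inverse c) * Poly_Mapping.single 0 c = (1 :: 'k mpoly)"
    by (simp add: mult_single)
  then show False
    using mpoly_ideal_mult[OF mpoly_prime_ideal const_in_carrier assms] mpoly_prime_one by metis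
qed

end


section \<open>The Krull dimension of the polynomial ring\<close>

definition power_product :: "(nat \<Rightarrow> 'a::comm_monoid_mult) \<Rightarrow> nat list \<Rightarrow> 'a" where
  "power_product f a = (\<Prod>j<length a. f j ^ (a ! j))"

lemma power_product_Cons: "power_product f (e # a) = f 0 ^ e * power_product (f \<circ> Suc) a"
  by (simp add: power_product_def prod.lessThan_Suc_shift del: prod.lessThan_Suc)

lemma carrier_power_product:
  assumes "\<And>j. j < length a \<Longrightarrow> f j \<in> carrier (mpoly_ring V)"
  shows "power_product f a \<in> carrier (mpoly_ring V)"
  unfolding power_product_def using assms by (intro carrier_prod carrier_power) auto

text \<open>
  The statement is about relations modulo \<open>C 0\<close> and not about relations in the ring, because the
  induction passes to the chain that starts at \<open>C 1\<close>: there \<open>f 0\<close> vanishes, and what remains of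
  the relation, after division by a power of \<open>f 0\<close>, involves only \<open>f 1, f 2, \<dots>\<close>. At the end of
  the chain a relation is a constant, which lies in a prime only if it is zero.
\<close>

lemma chain_witnesses_algebraically_independent:
  fixes C :: "nat \<Rightarrow> 'k::field mpoly set"
  assumes "\<And>i. i \<le> r \<Longrightarrow> primeideal (C i) (mpoly_ring V)"
    and "\<And>i. i < r \<Longrightarrow> C i \<subseteq> C (Suc i)"
    and "\<And>i. i < r \<Longrightarrow> f i \<in> C (Suc i) - C i"
    and "finite A" "\<And>a. a \<in> A \<Longrightarrow> length a = r"
    and "(\<Sum>a\<in>A. Poly_Mapping.single 0 (c a) * power_product f a) \<in> C 0"
    and "a \<in> A"
  shows "c a = 0"
  using assms
proof (induction r arbitrary: C f A c a)
  case 0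
  then have "A = {[]}" "a = []" by auto
  with 0 have "Poly_Mapping.single 0 (c a) \<in> C 0"
    by (simp add: power_product_def)
  then show ?case using mpoly_prime_const[of "C 0" V] 0 by auto
next
  case (Suc r)
  have f_carrier: "f i \<in> carrier (mpoly_ring V)" if "i < Suc r" for i
    using Suc.prems(3)[of i] that
      mpoly_ideal_subset[OF mpoly_prime_ideal[OF Suc.prems(1)[of "Suc i"]]] by auto
  have C0: "primeideal (C 0) (mpoly_ring V)" and C1: "primeideal (C 1) (mpoly_ring V)"
    using Suc.prems(1) by auto
  define g where "g a = Poly_Mapping.single 0 (c a) * power_product (f \<circ> Suc) (tl a)" for a
  have term_eq: "Poly_Mapping.single 0 (c a) * power_product f a = f 0 ^ hd a * g a" if "a \<in> A" for a
  proof -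
    from Suc.prems(5)[OF that] obtain e b where "a = e # b" by (cases a) auto
    then show ?thesis by (simp add: g_def power_product_Cons algebra_simps)
  qed
  have g_carrier: "g a \<in> carrier (mpoly_ring V)" if "a \<in> A" for a
    unfolding g_def using Suc.prems(5)[OF that] f_carrier
    by (intro carrier_mult const_in_carrier carrier_power_product) auto
  show ?case
  proof (rule ccontr)
    assume nz: "c a \<noteq> 0"
    define B where "B = {a \<in> A. c a \<noteq> 0}"
    have B: "finite B" "a \<in> B" "B \<subseteq> A"
      using Suc.prems nz by (auto simp: B_def)
    \<comment> \<open>The relation is formally divisible by \<open>f 0 ^ e\<close>, and \<open>f 0\<close> lies outside the prime \<open>C 0\<close>, so
      the quotient \<open>q\<close> is in \<open>C 0\<close> as well.\<close>
    define e where "e = Min (hd ` B)"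
    have e_le: "e \<le> hd b" if "b \<in> B" for b
      using B that by (simp add: e_def)
    have "e \<in> hd ` B"
      unfolding e_def using B by (intro Min_in) auto
    then obtain b where b: "b \<in> B" "hd b = e" by auto
    define q where "q = (\<Sum>a\<in>B. f 0 ^ (hd a - e) * g a)"
    have "(\<Sum>a\<in>A. Poly_Mapping.single 0 (c a) * power_product f a) = (\<Sum>a\<in>A. f 0 ^ hd a * g a)"
      by (intro sum.cong) (auto simp: term_eq)
    also have "\<dots> = (\<Sum>a\<in>B. f 0 ^ hd a * g a)"
      using Suc.prems(4) by (intro sum.mono_neutral_right) (auto simp: B_def g_def)
    also have "\<dots> = f 0 ^ e * q"
      unfolding q_def sum_distrib_left
      by (intro sum.cong refl) (simp add: e_le flip: mult.assoc power_add)
    finally have "f 0 ^ e * q \<in> C 0"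
      using Suc.prems(6) by simp
    moreover have "q \<in> carrier (mpoly_ring V)"
    proof -
      have "ideal (carrier (mpoly_ring V)) (mpoly_ring V :: 'k mpoly ring)"
        using cring_mpoly_ring by (intro ring.oneideal) (rule cring.axioms)
      moreover have "f 0 ^ (hd a - e) * g a \<in> carrier (mpoly_ring V)" if "a \<in> B" for a
        by (rule carrier_mult[OF carrier_power[OF f_carrier] g_carrier]) (use that B in auto)
      ultimately show ?thesis
        unfolding q_def by (rule mpoly_ideal_sum)
    qed
    ultimately have "f 0 ^ e \<in> C 0 \<or> q \<in> C 0"
      using mpoly_prime_mult[OF C0 carrier_power[OF f_carrier[of 0]]] by simp
    moreover have "f 0 ^ e \<notin> C 0"
      using mpoly_prime_power[OF C0 f_carrier[of 0]] Suc.prems(3)[of 0] by auto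
    ultimately have "q \<in> C 0" by simp
    then have q1: "q \<in> C 1"
      using Suc.prems(2)[of 0] by auto
    \<comment> \<open>In \<open>C 1\<close> the terms of \<open>q\<close> that still contain \<open>f 0\<close> can be dropped; those indexed by \<open>B0\<close>
      remain.\<close>
    define B0 where "B0 = {a \<in> B. hd a = e}"
    have "(\<Sum>a\<in>B - B0. f 0 ^ (hd a - e) * g a) \<in> C 1"
    proof (rule mpoly_ideal_sum[OF mpoly_prime_ideal[OF C1]])
      fix a assume a: "a \<in> B - B0"
      then have "e < hd a"
        using e_le[of a] by (auto simp: B0_def)
      then obtain d where "hd a - e = Suc d"
        using Suc_diff_Suc by metis
      then have split: "f 0 ^ (hd a - e) * g a = (f 0 ^ d * g a) * f 0"
        by (simp add: ac_simps)
      have "f 0 ^ d * g a \<in> carrier (mpoly_ring V)"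
        by (rule carrier_mult[OF carrier_power[OF f_carrier] g_carrier]) (use a B in auto)
      moreover have "f 0 \<in> C 1"
        using Suc.prems(3)[of 0] by simp
      ultimately show "f 0 ^ (hd a - e) * g a \<in> C 1"
        unfolding split by (rule mpoly_ideal_mult[OF mpoly_prime_ideal[OF C1]])
    qed
    moreover have "q = (\<Sum>a\<in>B - B0. f 0 ^ (hd a - e) * g a) + (\<Sum>a\<in>B0. g a)"
    proof -
      have "(\<Sum>a\<in>B0. f 0 ^ (hd a - e) * g a) = (\<Sum>a\<in>B0. g a)"
        by (intro sum.cong refl) (simp add: B0_def)
      then show ?thesis
        using sum.subset_diff[of B0 B "\<lambda>a. f 0 ^ (hd a - e) * g a"] B(1) by (simp add: q_def B0_def)
    qed
    ultimately have "(\<Sum>a\<in>B0. g a) \<in> C 1"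
      using mpoly_ideal_diff[OF mpoly_prime_ideal[OF C1] q1, of "\<Sum>a\<in>B - B0. f 0 ^ (hd a - e) * g a"]
      by simp
    moreover have "inj_on tl B0"
    proof (rule inj_onI)
      fix x y assume "x \<in> B0" "y \<in> B0" "tl x = tl y"
      then show "x = y"
        using B Suc.prems(5)[of x] Suc.prems(5)[of y]
        by (cases x; cases y) (auto simp: B0_def)
    qed
    moreover have "(\<Sum>a\<in>B0. g a) = (\<Sum>a\<in>B0. Poly_Mapping.single 0 (c (e # tl a)) * power_product (f \<circ> Suc) (tl a))"
    proof (rule sum.cong)
      fix x assume "x \<in> B0"
      then have "x = e # tl x"
        using B Suc.prems(5)[of x] by (cases x) (auto simp: B0_def)
      then show "g x = Poly_Mapping.single 0 (c (e # tl x)) * power_product (f \<circ> Suc) (tl x)"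
        by (simp add: g_def)
    qed simp
    ultimately have tail_sum:
      "(\<Sum>a\<in>tl ` B0. Poly_Mapping.single 0 (c (e # a)) * power_product (f \<circ> Suc) a) \<in> C 1"
      by (simp add: sum.reindex)
    have "c (e # tl b) = 0"
    proof (rule Suc.IH[where C = "C \<circ> Suc" and f = "f \<circ> Suc" and A = "tl ` B0"
            and c = "\<lambda>a. c (e # a)" and a = "tl b"])
      show "(\<Sum>a\<in>tl ` B0. Poly_Mapping.single 0 (c (e # a)) * power_product (f \<circ> Suc) a) \<in> (C \<circ> Suc) 0"
        using tail_sum by simp
    qed (use B b Suc.prems in \<open>auto simp: B0_def\<close>)
    moreover have "e # tl b = b"
      using b B Suc.prems(5)[of b] by (cases b) auto
    ultimately show False
      using b by (simp add: B_def)
  qed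
qed

text \<open>
  The vectors form a family instead of a set, so a repeated vector is itself a nontrivial relation.
\<close>

lemma (in vector_space) nontrivial_relation_if_card_less:
  assumes "finite A" "finite S" "card S < card A" "v ` A \<subseteq> span S"
  shows "\<exists>c. (\<Sum>a\<in>A. scale (c a) (v a)) = 0 \<and> (\<exists>a\<in>A. c a \<noteq> 0)"
proof (cases "inj_on v A")
  case True
  then have "dependent (v ` A)"
    using independent_span_bound[of S "v ` A"] assms by (auto simp: card_image)
  then obtain u x where u: "(\<Sum>x\<in>v ` A. scale (u x) x) = 0" "x \<in> v ` A" "u x \<noteq> 0"
    using assms(1) by (auto simp: dependent_finite)
  then have "(\<Sum>a\<in>A. scale (u (v a)) (v a)) = 0"
    using True by (simp add: sum.reindex)
  with u show ?thesis by (intro exI[of _ "u \<circ> v"]) auto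
next
  case False
  then obtain a b where ab: "a \<in> A" "b \<in> A" "v a = v b" "a \<noteq> b"
    by (auto simp: inj_on_def)
  define c where "c x = (if x = a then 1 else if x = b then - 1 else (0 :: 'a))" for x
  have "(\<Sum>x\<in>A. scale (c x) (v x)) = (\<Sum>x\<in>{a, b}. scale (c x) (v x))"
    using ab assms(1) by (intro sum.mono_neutral_right) (auto simp: c_def)
  also have "\<dots> = 0"
    using ab by (simp add: c_def)
  finally show ?thesis
    using ab by (intro exI[of _ c]) (auto simp: c_def)
qed

definition exponent_box :: "nat set \<Rightarrow> nat \<Rightarrow> (nat \<Rightarrow>\<^sub>0 nat) set" where
  "exponent_box V d = {a. Poly_Mapping.keys a \<subseteq> V \<and> (\<forall>j. Poly_Mapping.lookup a j \<le> d)}"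

lemma card_exponent_box:
  assumes "finite V"
  shows "finite (exponent_box V d)" "card (exponent_box V d) \<le> Suc d ^ card V"
proof -
  let ?h = "\<lambda>a. restrict (Poly_Mapping.lookup a) V"
  have inj: "inj_on ?h (exponent_box V d)"
  proof (rule inj_onI, rule poly_mapping_eqI)
    fix a b j
    assume *: "a \<in> exponent_box V d" "b \<in> exponent_box V d" "?h a = ?h b"
    show "Poly_Mapping.lookup a j = Poly_Mapping.lookup b j"
    proof (cases "j \<in> V")
      case True
      then show ?thesis using *(3) by (metis restrict_apply')
    next
      case False
      then have "j \<notin> Poly_Mapping.keys a" "j \<notin> Poly_Mapping.keys b"
        using * by (auto simp: exponent_box_def)
      then show ?thesis by (simp add: in_keys_iff)
    qed
  qed
  have sub: "?h ` exponent_box V d \<subseteq> (\<Pi>\<^sub>E j\<in>V. {..d})"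
    by (auto simp: exponent_box_def)
  have fin: "finite (\<Pi>\<^sub>E j\<in>V. {..d})"
    using assms by (intro finite_PiE) auto
  show "finite (exponent_box V d)"
    using finite_imageD[OF finite_subset[OF sub fin] inj] .
  have "card (exponent_box V d) \<le> card (\<Pi>\<^sub>E j\<in>V. {..d})"
    by (rule card_inj_on_le[OF inj sub fin])
  then show "card (exponent_box V d) \<le> Suc d ^ card V"
    using assms by (simp add: card_PiE)
qed

lemma keys_mult_box:
  fixes p q :: "'k::field mpoly"
  assumes "Poly_Mapping.keys p \<subseteq> exponent_box V d" "Poly_Mapping.keys q \<subseteq> exponent_box V e"
  shows "Poly_Mapping.keys (p * q) \<subseteq> exponent_box V (d + e)"
proof
  fix a assume "a \<in> Poly_Mapping.keys (p * q)"
  then obtain b c where "a = b + c" "b \<in> Poly_Mapping.keys p" "c \<in> Poly_Mapping.keys q"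
    by (rule keys_mult_cases)
  moreover from this have "b \<in> exponent_box V d" "c \<in> exponent_box V e"
    using assms by auto
  ultimately show "a \<in> exponent_box V (d + e)"
    by (auto simp: exponent_box_def keys_monom_add lookup_add add_mono)
qed

lemma keys_one_box: "Poly_Mapping.keys (1 :: 'k::field mpoly) \<subseteq> exponent_box V d"
  by (simp add: exponent_box_def)

lemma keys_power_box:
  fixes p :: "'k::field mpoly"
  assumes "Poly_Mapping.keys p \<subseteq> exponent_box V d"
  shows "Poly_Mapping.keys (p ^ e) \<subseteq> exponent_box V (e * d)"
  by (induction e) (use keys_one_box keys_mult_box[OF assms] in auto)

lemma keys_prod_box:
  fixes f :: "'i \<Rightarrow> 'k::field mpoly"
  assumes "\<And>i. i \<in> A \<Longrightarrow> Poly_Mapping.keys (f i) \<subseteq> exponent_box V (d i)"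
  shows "Poly_Mapping.keys (prod f A) \<subseteq> exponent_box V (sum d A)"
  using assms
proof (induction A rule: infinite_finite_induct)
  case (insert i A)
  then show ?case
    using keys_mult_box[of "f i" V "d i" "prod f A" "sum d A"] by simp
qed (simp_all add: exponent_box_def)

lemma exponent_box_mono: "d \<le> e \<Longrightarrow> exponent_box V d \<subseteq> exponent_box V e"
  unfolding exponent_box_def using le_trans by blast

lemma carrier_keys_box:
  assumes "p \<in> carrier (mpoly_ring V)"
  shows "\<exists>d. Poly_Mapping.keys p \<subseteq> exponent_box V d"
proof -
  define d where "d = (\<Sum>a\<in>Poly_Mapping.keys p. \<Sum>j\<in>Poly_Mapping.keys a. Poly_Mapping.lookup a j)"
  have "Poly_Mapping.lookup a j \<le> d" if a: "a \<in> Poly_Mapping.keys p" for a j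
  proof (cases "j \<in> Poly_Mapping.keys a")
    case True
    then have "Poly_Mapping.lookup a j \<le> (\<Sum>j\<in>Poly_Mapping.keys a. Poly_Mapping.lookup a j)"
      by (intro member_le_sum) auto
    also have "\<dots> \<le> d"
      unfolding d_def using a
      by (intro member_le_sum[where f = "\<lambda>a. \<Sum>j\<in>Poly_Mapping.keys a. Poly_Mapping.lookup a j"]) auto
    finally show ?thesis .
  qed (simp add: in_keys_iff)
  then have "Poly_Mapping.keys p \<subseteq> exponent_box V d"
    using assms by (auto simp: exponent_box_def mem_carrier_mpoly_ring)
  then show ?thesis by blast
qed

text \<open>
  Restrict the exponents of \<open>f 0, \<dots>, f (r - 1)\<close> to values below \<open>M\<close>. The \<open>M ^ r\<close> power products
  only involve monomials whose exponents are linearly bounded in \<open>M\<close>, and the number of these grows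
  like \<open>M ^ card V\<close>. For large \<open>M\<close> the power products are linearly dependent.
\<close>

lemma algebraic_relation_if_too_many:
  fixes f :: "nat \<Rightarrow> 'k::field mpoly"
  assumes "finite V" "card V < r" "\<And>i. i < r \<Longrightarrow> f i \<in> carrier (mpoly_ring V)"
  obtains A c a where "finite A" "\<forall>a \<in> A. length a = r"
    "(\<Sum>a\<in>A. Poly_Mapping.single 0 (c a) * power_product f a) = 0" "a \<in> A" "c a \<noteq> 0"
proof -
  let ?n = "card V"
  have "\<forall>i<r. \<exists>d. Poly_Mapping.keys (f i) \<subseteq> exponent_box V d"
    using carrier_keys_box assms(3) by blast
  then obtain d' where d': "Poly_Mapping.keys (f i) \<subseteq> exponent_box V (d' i)" if "i < r" for i
    by metis
  define d where "d = (\<Sum>i<r. d' i)"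
  have d: "Poly_Mapping.keys (f i) \<subseteq> exponent_box V d" if "i < r" for i
  proof -
    have "d' i \<le> d" unfolding d_def using that by (intro member_le_sum) auto
    with d'[OF that] exponent_box_mono show ?thesis by blast
  qed
  \<comment> \<open>The exponents that occur are at most \<open>N = r * M * d\<close>, and \<open>Suc N \<le> Suc (r * d) * M\<close>. Hence the
    power products outnumber the monomials as soon as \<open>M\<close> exceeds \<open>Suc (r * d) ^ card V\<close>.\<close>
  define M where "M = Suc (Suc (r * d) ^ ?n)"
  define N where "N = r * (M * d)"
  define A where "A = {a. set a \<subseteq> {..<M} \<and> length a = r}"
  define S where "S = (\<lambda>a. Poly_Mapping.single a (1 :: 'k)) ` exponent_box V N"
  have A: "finite A" "card A = M ^ r"
    unfolding A_def using finite_lists_length_eq[of "{..<M}" r] card_lists_length_eq[of "{..<M}" r]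
    by auto
  have S: "finite S" "card S \<le> Suc N ^ ?n"
    using card_exponent_box[OF assms(1), of N]
      card_image_le[of "exponent_box V N" "\<lambda>a. Poly_Mapping.single a (1 :: 'k)"]
    unfolding S_def by auto
  have "Suc N \<le> Suc (r * d) * M"
    by (simp add: N_def M_def algebra_simps)
  then have "Suc N ^ ?n \<le> (Suc (r * d) * M) ^ ?n"
    by (rule power_mono) simp
  also have "\<dots> = Suc (r * d) ^ ?n * M ^ ?n"
    by (rule power_mult_distrib)
  also have "\<dots> < M * M ^ ?n"
    by (intro mult_strict_right_mono) (auto simp: M_def)
  also have "\<dots> = M ^ Suc ?n" by simp
  also have "\<dots> \<le> M ^ r"
    using assms(2) by (intro power_increasing) (auto simp: M_def)
  finally have card: "card S < card A"
    using S A by simp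
  interpret vector_space "\<lambda>c (p :: 'k mpoly). Poly_Mapping.single 0 c * p"
    by unfold_locales (simp_all add: distrib_left distrib_right single_add mult_single flip: mult.assoc)
  have "power_product f a \<in> span S" if a: "a \<in> A" for a
  proof -
    have "Poly_Mapping.keys (power_product f a) \<subseteq> exponent_box V (\<Sum>j<r. a ! j * d)"
    proof -
      have "Poly_Mapping.keys (f j ^ (a ! j)) \<subseteq> exponent_box V (a ! j * d)" if "j < r" for j
        by (rule keys_power_box[OF d[OF that]])
      then show ?thesis
        using a keys_prod_box[of "{..<r}" "\<lambda>j. f j ^ (a ! j)" V "\<lambda>j. a ! j * d"]
        by (simp add: power_product_def A_def)
    qed
    also have "\<dots> \<subseteq> exponent_box V N"
    proof (rule exponent_box_mono)
      have "a ! j * d \<le> M * d" if "j < r" for j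
      proof -
        have "a ! j \<in> {..<M}"
          using that a nth_mem[of j a] unfolding A_def by blast
        then show ?thesis by (intro mult_right_mono) auto
      qed
      then have "(\<Sum>j<r. a ! j * d) \<le> (\<Sum>j<r. M * d)"
        by (intro sum_mono) auto
      then show "(\<Sum>j<r. a ! j * d) \<le> N"
        by (simp add: N_def)
    qed
    finally have sub: "Poly_Mapping.keys (power_product f a) \<subseteq> exponent_box V N" .
    show ?thesis
      by (subst mpoly_expansion, rule span_sum, rule span_scale, rule span_base)
        (use sub in \<open>auto simp: S_def\<close>)
  qed
  then obtain c where "(\<Sum>a\<in>A. Poly_Mapping.single 0 (c a) * power_product f a) = 0"
    "\<exists>a\<in>A. c a \<noteq> 0"
    using nontrivial_relation_if_card_less[OF A(1) S(1) card, of "power_product f"] by blast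
  with A that show ?thesis by (auto simp: A_def)
qed

text \<open>
  One half of the theorem that a polynomial ring in \<open>card V\<close> variables has Krull dimension \<open>card V\<close>.
\<close>

theorem prime_chain_length_le_card_variables:
  fixes P :: "'k::field mpoly set"
  assumes "finite V" "prime_chain (mpoly_ring V) P r C"
  shows "r \<le> card V"
proof (rule ccontr)
  assume "\<not> r \<le> card V"
  then have r: "card V < r" by simp
  have C: "\<And>i. i \<le> r \<Longrightarrow> primeideal (C i) (mpoly_ring V)" "\<And>i. i < r \<Longrightarrow> C i \<subset> C (Suc i)"
    using assms(2) by (auto simp: prime_chain_def)
  then have "\<forall>i<r. \<exists>p. p \<in> C (Suc i) - C i" by blast
  then obtain f where f: "f i \<in> C (Suc i) - C i" if "i < r" for i by metis
  have "f i \<in> carrier (mpoly_ring V)" if "i < r" for i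
    using f[OF that] mpoly_ideal_subset[OF mpoly_prime_ideal[OF C(1)[of "Suc i"]]] that by auto
  with assms(1) r obtain A c a where "finite A" "\<forall>a \<in> A. length a = r"
    "(\<Sum>a\<in>A. Poly_Mapping.single 0 (c a) * power_product f a) = 0" "a \<in> A" "c a \<noteq> 0"
    by (rule algebraic_relation_if_too_many)
  then show False
    using chain_witnesses_algebraically_independent[of r C V f A c a] C f
      mpoly_ideal_zero[OF mpoly_prime_ideal[OF C(1)[of 0]]] by auto
qed


section \<open>Ideals generated by variables\<close>

text \<open>
  For \<open>D \<subseteq> V\<close>, this is the ideal generated by the variables in \<open>D\<close>: it is an ideal that contains
  them, and the least one by \<open>var_ideal_least\<close>. Describing it by the monomials that occur in its
  elements reduces membership to a condition on single monomials.
\<close>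

definition var_ideal :: "nat set \<Rightarrow> nat set \<Rightarrow> 'k::field mpoly set" where
  "var_ideal V D = {p \<in> carrier (mpoly_ring V). \<forall>a \<in> Poly_Mapping.keys p. Poly_Mapping.keys a \<inter> D \<noteq> {}}"

lemma var_ideal_mult:
  assumes "p \<in> carrier (mpoly_ring V)" "q \<in> var_ideal V D"
  shows "p * q \<in> var_ideal V D"
proof -
  have "Poly_Mapping.keys a \<inter> D \<noteq> {}" if "a \<in> Poly_Mapping.keys (p * q)" for a
    using that by (rule keys_mult_cases) (use assms in \<open>auto simp: var_ideal_def keys_monom_add\<close>)
  then show ?thesis
    using assms carrier_mult by (auto simp: var_ideal_def)
qed

lemma var_ideal_add:
  assumes "p \<in> var_ideal V D" "q \<in> var_ideal V D"
  shows "p + q \<in> var_ideal V D"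
  using assms Poly_Mapping.keys_add[of p q]
  unfolding var_ideal_def mem_carrier_mpoly_ring by blast

lemma var_ideal_ideal: "ideal (var_ideal V D) (mpoly_ring V :: 'k::field mpoly ring)"
proof (rule idealI)
  show ring: "ring (mpoly_ring V :: 'k mpoly ring)"
    using cring_mpoly_ring by (rule cring.axioms)
  interpret ring "mpoly_ring V :: 'k mpoly ring" by (rule ring)
  show "subgroup (var_ideal V D) (add_monoid (mpoly_ring V :: 'k mpoly ring))"
  proof (rule group.subgroupI)
    fix p :: "'k mpoly"
    assume p: "p \<in> var_ideal V D"
    then have "- p \<in> var_ideal V D" "p \<in> carrier (mpoly_ring V)" "- p \<in> carrier (mpoly_ring V)"
      by (auto simp: var_ideal_def mem_carrier_mpoly_ring)
    then show "inv\<^bsub>add_monoid (mpoly_ring V)\<^esub> p \<in> var_ideal V D"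
      using minus_equality[of "- p" p] by (simp add: a_inv_def)
  next
    have "0 \<in> var_ideal V D" by (simp add: var_ideal_def mem_carrier_mpoly_ring)
    then show "var_ideal V D \<noteq> ({} :: 'k mpoly set)" by blast
  next
    fix p q :: "'k mpoly"
    assume "p \<in> var_ideal V D" "q \<in> var_ideal V D"
    then show "p \<otimes>\<^bsub>add_monoid (mpoly_ring V)\<^esub> q \<in> var_ideal V D"
      by (simp add: var_ideal_add)
  qed (use a_group in \<open>auto simp: var_ideal_def\<close>)
next
  fix p q :: "'k mpoly"
  assume "p \<in> var_ideal V D" "q \<in> carrier (mpoly_ring V)"
  then have "q * p \<in> var_ideal V D" by (rule var_ideal_mult[rotated])
  then show "q \<otimes>\<^bsub>mpoly_ring V\<^esub> p \<in> var_ideal V D" "p \<otimes>\<^bsub>mpoly_ring V\<^esub> q \<in> var_ideal V D"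
    by (simp_all add: mult.commute)
qed

text \<open>
  The part \<open>p0\<close> is the image of \<open>p\<close> under the substitution \<open>x\<^sub>j = 0\<close> for \<open>j \<in> D\<close>; modulo the ideal it
  represents \<open>p\<close>.
\<close>

lemma split_off_var_ideal:
  fixes p :: "'k::field mpoly"
  assumes "p \<in> carrier (mpoly_ring V)"
  obtains p0 p1 where "p = p0 + p1" "p0 \<in> carrier (mpoly_ring V)" "p1 \<in> var_ideal V D"
    "\<forall>a \<in> Poly_Mapping.keys p0. Poly_Mapping.keys a \<inter> D = {}"
proof
  let ?m = "\<lambda>a. Poly_Mapping.single a (Poly_Mapping.lookup p a)"
  let ?K = "{a \<in> Poly_Mapping.keys p. Poly_Mapping.keys a \<inter> D = {}}"
  let ?p0 = "\<Sum>a\<in>?K. ?m a" and ?p1 = "\<Sum>a\<in>Poly_Mapping.keys p - ?K. ?m a"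
  have lookup: "Poly_Mapping.lookup (\<Sum>a\<in>B. ?m a) b = (if b \<in> B then Poly_Mapping.lookup p b else 0)"
    if "finite B" for B b
    using that by (simp add: lookup_sum lookup_single when_def)
  show "p = ?p0 + ?p1"
    by (rule poly_mapping_eqI) (auto simp: lookup lookup_add in_keys_iff)
  show "?p0 \<in> carrier (mpoly_ring V)" "?p1 \<in> var_ideal V D"
    using assms by (auto simp: var_ideal_def mem_carrier_mpoly_ring lookup in_keys_iff split: if_splits)
  show "\<forall>a \<in> Poly_Mapping.keys ?p0. Poly_Mapping.keys a \<inter> D = {}"
  proof
    fix a assume "a \<in> Poly_Mapping.keys ?p0"
    then have "Poly_Mapping.lookup ?p0 a \<noteq> 0" by (rule in_keys_iff[THEN iffD1])
    then show "Poly_Mapping.keys a \<inter> D = {}"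
      by (simp add: lookup split: if_splits)
  qed
qed

text \<open>
  The residue ring is a polynomial ring in the variables outside \<open>D\<close>, hence a domain: for the
  representatives \<open>p0\<close> and \<open>q0\<close>, the product \<open>p0 * q0\<close> has no variables from \<open>D\<close>, so it lies in the
  ideal only if it is zero.
\<close>

lemma var_ideal_prime: "primeideal (var_ideal V D) (mpoly_ring V :: 'k::field mpoly ring)"
proof (rule primeidealI)
  show "ideal (var_ideal V D) (mpoly_ring V :: 'k mpoly ring)"
    by (rule var_ideal_ideal)
  show "cring (mpoly_ring V :: 'k mpoly ring)"
    by (rule cring_mpoly_ring)
  have "1 \<notin> (var_ideal V D :: 'k mpoly set)" by (simp add: var_ideal_def)
  then show "carrier (mpoly_ring V) \<noteq> (var_ideal V D :: 'k mpoly set)"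
    using carrier_one by blast
next
  fix p q :: "'k mpoly"
  assume p: "p \<in> carrier (mpoly_ring V)" and q: "q \<in> carrier (mpoly_ring V)"
    and pq: "p \<otimes>\<^bsub>mpoly_ring V\<^esub> q \<in> var_ideal V D"
  note I = var_ideal_ideal[of V D]
  from p obtain p0 p1 where p01: "p = p0 + p1" "p0 \<in> carrier (mpoly_ring V)" "p1 \<in> var_ideal V D"
    "\<forall>a \<in> Poly_Mapping.keys p0. Poly_Mapping.keys a \<inter> D = {}"
    by (rule split_off_var_ideal)
  from q obtain q0 q1 where q01: "q = q0 + q1" "q0 \<in> carrier (mpoly_ring V)" "q1 \<in> var_ideal V D"
    "\<forall>a \<in> Poly_Mapping.keys q0. Poly_Mapping.keys a \<inter> D = {}"
    by (rule split_off_var_ideal)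
  have "p0 * q0 = p * q - (p0 * q1 + q * p1)"
    by (simp add: p01(1) q01(1) algebra_simps)
  then have "p0 * q0 \<in> var_ideal V D"
    using mpoly_ideal_diff[OF I, of "p * q" "p0 * q1 + q * p1"] pq
      mpoly_ideal_add[OF I var_ideal_mult[OF p01(2) q01(3)] var_ideal_mult[OF q p01(3)]] by simp
  moreover have "Poly_Mapping.keys a \<inter> D = {}" if "a \<in> Poly_Mapping.keys (p0 * q0)" for a
    using that by (rule keys_mult_cases) (use p01(4) q01(4) in \<open>auto simp: keys_monom_add\<close>)
  ultimately have "Poly_Mapping.keys (p0 * q0) = {}"
    by (auto simp: var_ideal_def)
  then have "p0 * q0 = 0" by simp
  then have "p0 = 0 \<or> q0 = 0" by simp
  then show "p \<in> var_ideal V D \<or> q \<in> var_ideal V D"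
    using p01 q01 by auto
qed

lemma mvar_in_var_ideal: "j \<in> V \<Longrightarrow> (mvar j :: 'k::field mpoly) \<in> var_ideal V D \<longleftrightarrow> j \<in> D"
  by (simp add: var_ideal_def mvar_def mem_carrier_mpoly_ring)

lemma var_ideal_mono: "D \<subseteq> E \<Longrightarrow> var_ideal V D \<subseteq> var_ideal V E"
  by (auto simp: var_ideal_def)

lemma var_ideal_strict_mono:
  assumes "D \<subset> E" "E \<subseteq> V"
  shows "var_ideal V D \<subset> (var_ideal V E :: 'k::field mpoly set)"
proof -
  from assms obtain j where "j \<in> E" "j \<notin> D" "j \<in> V" by blast
  then have "(mvar j :: 'k mpoly) \<in> var_ideal V E - var_ideal V D"
    by (simp add: mvar_in_var_ideal)
  then show ?thesis
    using var_ideal_mono[of D E V] assms by blast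
qed

lemma var_ideal_least:
  fixes I :: "'k::field mpoly set"
  assumes I: "ideal I (mpoly_ring V)" and "\<And>j. j \<in> D \<Longrightarrow> mvar j \<in> I"
  shows "var_ideal V D \<subseteq> I"
proof
  fix p :: "'k mpoly"
  assume p: "p \<in> var_ideal V D"
  show "p \<in> I"
  proof (subst mpoly_expansion, rule mpoly_ideal_sum[OF I])
    fix a assume a: "a \<in> Poly_Mapping.keys p"
    with p obtain j where j: "j \<in> Poly_Mapping.keys a" "j \<in> D" 
      by (auto simp: var_ideal_def)
    define b where "b = a - Poly_Mapping.single j 1"
    have ab: "a = b + Poly_Mapping.single j 1"
      using j by (intro poly_mapping_eqI)
        (auto simp: b_def lookup_add lookup_minus lookup_single when_def in_keys_iff)
    have "Poly_Mapping.keys b \<subseteq> V"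
      using a p keys_monom_add[of b "Poly_Mapping.single j 1"]
      unfolding var_ideal_def mem_carrier_mpoly_ring ab by blast
    then have "Poly_Mapping.single b (Poly_Mapping.lookup p a) \<in> carrier (mpoly_ring V)"
      by (simp add: mem_carrier_mpoly_ring)
    from mpoly_ideal_mult[OF I this assms(2)[OF j(2)]]
    show "Poly_Mapping.single 0 (Poly_Mapping.lookup p a) * Poly_Mapping.single a 1 \<in> I"
      by (simp add: mvar_def mult_single ab)
  qed
qed

lemma var_ideal_chain:
  assumes "finite E" "D \<subseteq> E" "E \<subseteq> V"
  obtains C :: "nat \<Rightarrow> 'k::field mpoly set"
  where "prime_chain (mpoly_ring V) (var_ideal V E) (card E - card D) C" "C 0 = var_ideal V D"
proof -
  obtain xs where xs: "set xs = E - D" "distinct xs"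
    using assms finite_distinct_list[of "E - D"] by auto
  define C where "C i = (var_ideal V (D \<union> set (take i xs)) :: 'k mpoly set)" for i
  have len: "length xs = card E - card D"
    using distinct_card[OF xs(2)] xs(1) card_Diff_subset[of D E] finite_subset[OF assms(2,1)] assms(2)
    by simp
  have "C i \<subset> C (Suc i)" if i: "i < length xs" for i
  proof -
    have "xs ! i \<notin> set (take i xs)"
      using distinct_take[OF xs(2), of "Suc i"] i by (simp add: take_Suc_conv_app_nth)
    moreover have "xs ! i \<in> E - D"
      using i xs(1) nth_mem by blast
    moreover have "set (take (Suc i) xs) = insert (xs ! i) (set (take i xs))"
      using i by (simp add: take_Suc_conv_app_nth)
    moreover have "set (take i xs) \<subseteq> E"
      using xs(1) set_take_subset[of i xs] by blast
    ultimately show ?thesis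
      unfolding C_def using assms by (intro var_ideal_strict_mono) auto
  qed
  moreover have "C (length xs) = var_ideal V E"
    using xs assms by (simp add: C_def Un_absorb1)
  moreover have "primeideal (C i) (mpoly_ring V)" for i
    unfolding C_def by (rule var_ideal_prime)
  ultimately have "prime_chain (mpoly_ring V) (var_ideal V E) (card E - card D) C"
    unfolding prime_chain_def len by blast
  then show ?thesis
    by (rule that) (simp add: C_def)
qed

lemma prime_chain_append:
  assumes "prime_chain R P r C" "prime_chain R Q s C'" "C' 0 = P"
  shows "prime_chain R Q (r + s) (\<lambda>i. if i \<le> r then C i else C' (i - r))"
  unfolding prime_chain_def
proof (intro conjI allI impI)
  fix i assume i: "i < r + s"
  show "(if i \<le> r then C i else C' (i - r)) \<subset> (if Suc i \<le> r then C (Suc i) else C' (Suc i - r))"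
  proof (cases "i < r")
    case False
    then have "C' (i - r) \<subset> C' (Suc (i - r))" "Suc i - r = Suc (i - r)"
      using assms(2) i by (auto simp: prime_chain_def)
    moreover have "C i = C' (i - r)" if "i \<le> r"
      using False that assms(1,3) by (simp add: prime_chain_def)
    ultimately show ?thesis using False by auto
  qed (use assms(1) in \<open>auto simp: prime_chain_def\<close>)
qed (use assms in \<open>auto simp: prime_chain_def\<close>)

text \<open>
  A chain of length \<open>r\<close> that ends in the ideal of \<open>D\<close> continues to the ideal of all variables,
  with total length \<open>r + (card V - card D)\<close>, which the dimension of the ring bounds by \<open>card V\<close>.
\<close>

lemma prime_height_var_ideal_le:
  assumes "finite V" "D \<subseteq> V"
  shows "prime_height (mpoly_ring V) (var_ideal V D :: 'k::field mpoly set) \<le> enat (card D)"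
  unfolding prime_height_def
proof (rule SUP_least)
  fix r assume "r \<in> {r. \<exists>C. prime_chain (mpoly_ring V) (var_ideal V D :: 'k mpoly set) r C}"
  then obtain C where C: "prime_chain (mpoly_ring V) (var_ideal V D :: 'k mpoly set) r C" by blast
  obtain C' where "prime_chain (mpoly_ring V) (var_ideal V V :: 'k mpoly set) (card V - card D) C'"
    "C' 0 = var_ideal V D"
    by (rule var_ideal_chain[OF assms order_refl])
  from prime_chain_length_le_card_variables[OF assms(1) prime_chain_append[OF C this]]
  show "enat r \<le> enat (card D)"
    using card_mono[OF assms] by simp
qed

text \<open>
  Adjoining the variables in \<open>D\<close> one at a time gives a chain ending in the ideal of \<open>D\<close>; its last
  member can be replaced by the larger prime \<open>P\<close>.
\<close>

lemma card_le_prime_height: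
  fixes P :: "'k::field mpoly set"
  assumes "finite D" "D \<subseteq> V" "primeideal P (mpoly_ring V)" "\<And>j. j \<in> D \<Longrightarrow> mvar j \<in> P"
  shows "enat (card D) \<le> prime_height (mpoly_ring V) P"
proof -
  obtain C :: "nat \<Rightarrow> 'k mpoly set"
    where "prime_chain (mpoly_ring V) (var_ideal V D) (card D - card ({} :: nat set)) C" "C 0 = var_ideal V {}"
    by (rule var_ideal_chain[OF assms(1) empty_subsetI assms(2)])
  then have C: "prime_chain (mpoly_ring V) (var_ideal V D) (card D) C" by simp
  have sub: "var_ideal V D \<subseteq> P"
    by (rule var_ideal_least[OF mpoly_prime_ideal[OF assms(3)] assms(4)])
  have "prime_chain (mpoly_ring V) P (card D) (C(card D := P))"
    unfolding prime_chain_def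
  proof (intro conjI allI impI)
    fix i assume i: "i < card D"
    then have "C i \<subset> C (Suc i)" and "C (card D) \<subseteq> P"
      using C sub by (simp_all add: prime_chain_def)
    with i show "(C(card D := P)) i \<subset> (C(card D := P)) (Suc i)"
      by (cases "Suc i = card D") auto
  next
    fix i assume "i \<le> card D"
    then show "primeideal ((C(card D := P)) i) (mpoly_ring V)"
      using C assms(3) by (simp add: prime_chain_def)
  qed simp
  then have "card D \<in> {r. \<exists>C. prime_chain (mpoly_ring V) P r C}" by blast
  then show ?thesis
    unfolding prime_height_def by (rule SUP_upper)
qed


section \<open>Neighborhood ideals\<close>

lemma prod_mvar_in_var_ideal:
  assumes "finite W" "W \<subseteq> V" "W \<inter> D \<noteq> {}"
  shows "(\<Prod>j\<in>W. mvar j) \<in> (var_ideal V D :: 'k::field mpoly set)"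
proof -
  from assms obtain j where j: "j \<in> W" "j \<in> D" by blast
  have "(\<Prod>j\<in>W. mvar j) = (\<Prod>j\<in>W - {j}. mvar j) * (mvar j :: 'k mpoly)"
    using prod.remove[OF assms(1) j(1), of mvar] by (simp add: mult.commute)
  moreover have "(\<Prod>j\<in>W - {j}. mvar j :: 'k mpoly) \<in> carrier (mpoly_ring V)"
    using assms by (intro carrier_prod mvar_in_carrier) auto
  ultimately show ?thesis
    using var_ideal_mult[of _ V "mvar j" D] mvar_in_var_ideal[of j V D] j assms by auto
qed

context pair_graph
begin

lemma closed_nbhd_subset: "i \<in> pverts G \<Longrightarrow> closed_nbhd G i \<subseteq> pverts G"
  by (auto simp: closed_nbhd_def dest: in_arcsD2)

lemma finite_closed_nbhd: "i \<in> pverts G \<Longrightarrow> finite (closed_nbhd G i)"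
  using closed_nbhd_subset pair_finite_verts by (rule finite_subset)

lemma card_closed_nbhd:
  assumes "i \<in> pverts G"
  shows "card (closed_nbhd G i) = graph_degree G i + 1"
proof -
  have "out_arcs (with_proj G) i = Pair i ` {j. (i, j) \<in> parcs G}"
    by (auto simp: out_arcs_def)
  then have "graph_degree G i = card {j. (i, j) \<in> parcs G}"
    by (simp add: out_degree_def card_image inj_on_def)
  moreover have "i \<notin> {j. (i, j) \<in> parcs G}"
    using no_loops' by blast
  moreover have "finite {j. (i, j) \<in> parcs G}"
    using finite_closed_nbhd[OF assms] by (simp add: closed_nbhd_def)
  ultimately show ?thesis
    by (simp add: closed_nbhd_def)
qed

text \<open>
  This is the duality behind the choice of \<open>m\<close>. The closed neighborhood has \<open>graph_degree G i + 1\<close>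
  elements, so a \<open>k i\<close>-subset of it that avoids \<open>D\<close> exists exactly when at most
  \<open>graph_degree G i + 1 - k i = m i - 1\<close> of its elements lie in \<open>D\<close>.
\<close>

lemma multiple_dominating_iff_meets:
  assumes "D \<subseteq> pverts G" and mk: "\<And>i. i \<in> pverts G \<Longrightarrow> m i + k i = graph_degree G i + 2"
  shows "multiple_dominating G m D \<longleftrightarrow>
    (\<forall>i \<in> pverts G. \<forall>W. W \<subseteq> closed_nbhd G i \<and> card W = k i \<longrightarrow> W \<inter> D \<noteq> {})"
proof -
  have "m i \<le> card (closed_nbhd G i \<inter> D) \<longleftrightarrow>
      (\<forall>W. W \<subseteq> closed_nbhd G i \<and> card W = k i \<longrightarrow> W \<inter> D \<noteq> {})" if i: "i \<in> pverts G" for i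
  proof -
    note fin = finite_closed_nbhd[OF i]
    have "card (closed_nbhd G i \<inter> D) + card (closed_nbhd G i - D) = graph_degree G i + 1"
      using card_closed_nbhd[OF i] card_Int_Diff[OF fin] by metis
    then have "m i \<le> card (closed_nbhd G i \<inter> D) \<longleftrightarrow> \<not> k i \<le> card (closed_nbhd G i - D)"
      using mk[OF i] by linarith
    also have "k i \<le> card (closed_nbhd G i - D) \<longleftrightarrow> (\<exists>W \<subseteq> closed_nbhd G i - D. card W = k i)"
      using fin by (metis card_mono finite_Diff obtain_subset_with_card_n)
    also have "\<dots> \<longleftrightarrow> \<not> (\<forall>W. W \<subseteq> closed_nbhd G i \<and> card W = k i \<longrightarrow> W \<inter> D \<noteq> {})"
      by blast
    finally show ?thesis by blast
  qed
  with assms(1) show ?thesis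
    by (simp add: multiple_dominating_def)
qed

end

context
  fixes G :: "nat pair_pre_digraph"
  assumes G: "pair_graph G"
begin

interpretation pair_graph G by (rule G)

lemma nbhd_ideal_subset_iff:
  fixes I :: "'k::field mpoly set"
  assumes I: "ideal I (mpoly_ring (pverts G))"
  shows "nbhd_ideal G k \<subseteq> I \<longleftrightarrow>
    (\<forall>i \<in> pverts G. \<forall>W. W \<subseteq> closed_nbhd G i \<and> card W = k i \<longrightarrow> (\<Prod>j\<in>W. mvar j) \<in> I)"
proof -
  interpret R: cring "mpoly_ring (pverts G) :: 'k mpoly ring" by (rule cring_mpoly_ring)
  let ?gens = "\<lambda>i. {\<Prod>j\<in>W. mvar j :: 'k mpoly | W. W \<subseteq> closed_nbhd G i \<and> card W = k i}"
  have gens: "?gens i \<subseteq> carrier (mpoly_ring (pverts G))" if "i \<in> pverts G" for i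
    using closed_nbhd_subset[OF that] by (auto intro!: carrier_prod mvar_in_carrier)
  have idl: "Idl\<^bsub>mpoly_ring (pverts G)\<^esub> ?gens i \<subseteq> carrier (mpoly_ring (pverts G))"
    if "i \<in> pverts G" for i
    using R.genideal_ideal[OF gens[OF that]] by (rule mpoly_ideal_subset)
  have "nbhd_ideal G k \<subseteq> I \<longleftrightarrow> (\<Union>i\<in>pverts G. Idl\<^bsub>mpoly_ring (pverts G)\<^esub> ?gens i) \<subseteq> I"
    unfolding nbhd_ideal_def using idl I by (intro R.Idl_subset_ideal) auto
  also have "\<dots> \<longleftrightarrow> (\<forall>i\<in>pverts G. ?gens i \<subseteq> I)"
    using R.Idl_subset_ideal[OF I gens] by blast
  finally show ?thesis by blast
qed

lemma nbhd_ideal_subset_var_ideal: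
  assumes D: "multiple_dominating G m D"
    and mk: "\<And>i. i \<in> pverts G \<Longrightarrow> m i + k i = graph_degree G i + 2"
  shows "nbhd_ideal G k \<subseteq> (var_ideal (pverts G) D :: 'k::field mpoly set)"
  unfolding nbhd_ideal_subset_iff[OF var_ideal_ideal]
proof (intro ballI allI impI, elim conjE)
  fix i W assume i: "i \<in> pverts G" and W: "W \<subseteq> closed_nbhd G i" "card W = k i"
  have "D \<subseteq> pverts G"
    using D by (simp add: multiple_dominating_def)
  then have "W \<inter> D \<noteq> {}"
    using D multiple_dominating_iff_meets[of D m k, OF _ mk] i W by blast
  then show "(\<Prod>j\<in>W. mvar j) \<in> (var_ideal (pverts G) D :: 'k mpoly set)"
    using finite_subset[OF W(1) finite_closed_nbhd[OF i]] W(1) closed_nbhd_subset[OF i]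
    by (intro prod_mvar_in_var_ideal) auto
qed

lemma multiple_dominating_vars_of_prime:
  fixes P :: "'k::field mpoly set"
  assumes P: "primeideal P (mpoly_ring (pverts G))" and sub: "nbhd_ideal G k \<subseteq> P"
    and mk: "\<And>i. i \<in> pverts G \<Longrightarrow> m i + k i = graph_degree G i + 2"
  shows "multiple_dominating G m {j \<in> pverts G. mvar j \<in> P}"
proof (subst multiple_dominating_iff_meets[where k = k])
  show "\<forall>i \<in> pverts G. \<forall>W. W \<subseteq> closed_nbhd G i \<and> card W = k i \<longrightarrow>
      W \<inter> {j \<in> pverts G. (mvar j :: 'k mpoly) \<in> P} \<noteq> {}"
  proof (intro ballI allI impI, elim conjE)
    fix i W assume i: "i \<in> pverts G" and W: "W \<subseteq> closed_nbhd G i" "card W = k i"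
    have V: "W \<subseteq> pverts G"
      using W(1) closed_nbhd_subset[OF i] by (rule subset_trans)
    have "(\<Prod>j\<in>W. mvar j) \<in> P"
      using sub nbhd_ideal_subset_iff[OF mpoly_prime_ideal[OF P]] i W by blast
    moreover have "(mvar j :: 'k mpoly) \<in> carrier (mpoly_ring (pverts G))" if "j \<in> W" for j
      using that V by (intro mvar_in_carrier) auto
    ultimately have "\<exists>j \<in> W. (mvar j :: 'k mpoly) \<in> P"
      by (intro mpoly_prime_prod[OF P])
    then show "W \<inter> {j \<in> pverts G. (mvar j :: 'k mpoly) \<in> P} \<noteq> {}"
      using V by blast
  qed
qed (use mk in auto)

theorem ideal_height_nbhd_ideal:
  assumes k: "\<And>i. i \<in> pverts G \<Longrightarrow> 1 \<le> k i"
    and mk: "\<And>i. i \<in> pverts G \<Longrightarrow> m i + k i = graph_degree G i + 2"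
  shows "ideal_height (mpoly_ring (pverts G)) (nbhd_ideal G k :: 'k::field mpoly set)
     = enat (multiple_domination_number G m)"
proof (rule antisym)
  let ?doms = "{D. multiple_dominating G m D}"
  have fin: "finite ?doms"
    by (rule finite_subset[of _ "Pow (pverts G)"]) (auto simp: multiple_dominating_def pair_finite_verts)
  have "multiple_dominating G m (pverts G)"
    unfolding multiple_dominating_def
  proof (intro conjI ballI)
    fix i assume i: "i \<in> pverts G"
    then show "m i \<le> card (closed_nbhd G i \<inter> pverts G)"
      using closed_nbhd_subset[OF i] card_closed_nbhd[OF i] mk[OF i] k[OF i]
      by (simp add: Int_absorb2)
  qed simp
  then have "multiple_domination_number G m \<in> card ` ?doms"
    unfolding multiple_domination_number_def using fin by (intro Min_in) auto
  then obtain D where D: "multiple_dominating G m D" "card D = multiple_domination_number G m"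
    by auto
  have "ideal_height (mpoly_ring (pverts G)) (nbhd_ideal G k :: 'k mpoly set)
      \<le> prime_height (mpoly_ring (pverts G)) (var_ideal (pverts G) D :: 'k mpoly set)"
    unfolding ideal_height_def using nbhd_ideal_subset_var_ideal[OF D(1) mk] var_ideal_prime
    by (intro INF_lower) auto
  also have "\<dots> \<le> enat (card D)"
    using D pair_finite_verts by (intro prime_height_var_ideal_le) (auto simp: multiple_dominating_def)
  finally show "ideal_height (mpoly_ring (pverts G)) (nbhd_ideal G k :: 'k mpoly set)
      \<le> enat (multiple_domination_number G m)"
    using D by simp
  show "enat (multiple_domination_number G m)
      \<le> ideal_height (mpoly_ring (pverts G)) (nbhd_ideal G k :: 'k mpoly set)"
    unfolding ideal_height_def
  proof (rule INF_greatest)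
    fix P :: "'k mpoly set"
    assume "P \<in> {P. primeideal P (mpoly_ring (pverts G)) \<and> nbhd_ideal G k \<subseteq> P}"
    then have P: "primeideal P (mpoly_ring (pverts G))" "nbhd_ideal G k \<subseteq> P" by auto
    let ?D = "{j \<in> pverts G. mvar j \<in> P}"
    have "multiple_domination_number G m \<le> card ?D"
      unfolding multiple_domination_number_def
      using fin multiple_dominating_vars_of_prime[OF P mk] by (intro Min_le) auto
    also have "enat (card ?D) \<le> prime_height (mpoly_ring (pverts G)) P"
      using P pair_finite_verts by (intro card_le_prime_height) auto
    finally show "enat (multiple_domination_number G m) \<le> prime_height (mpoly_ring (pverts G)) P"
      by simp
  qed
qed

end

theorem corollary2p3:
  fixes G :: "nat pair_pre_digraph" and n :: nat and k m :: "nat \<Rightarrow> nat"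
  assumes "pair_graph G" and "pverts G = {1..n}"
    and no_isolated: "\<forall>i \<in> {1..n}. \<exists>j. (i, j) \<in> parcs G"
    and k: "\<forall>i \<in> {1..n}. 1 \<le> k i \<and> k i \<le> graph_degree G i + 1"
    and m: "\<forall>i \<in> {1..n}. int (m i) = int (graph_degree G i) - int (k i) + 2"
  shows "ideal_height (mpoly_ring {1..n}) (nbhd_ideal G k :: 'k::field mpoly set)
           = enat (multiple_domination_number G m)"
proof -
  have "m i + k i = graph_degree G i + 2" if "i \<in> pverts G" for i
    using m that assms(2) by force
  with ideal_height_nbhd_ideal[OF assms(1), of k m] k assms(2) show ?thesis
    by auto
qed

end
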